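(* If a hypersequent has a CAN-free derivation in $\mathbf{HMR}$, then it has a derivation in $\mathbf{HMR}$ that is both CAN-free and M-free.
   Context: Terms. Fix a countable set of variables $x,y,\dots$. Terms (in negation normal form) are generated by $A ::= x \mid \overline{x} \mid 0 \mid 1 \mid \overline{1} \mid A+A \mid rA \mid A\sqcup A \mid A\sqcap A \mid \Diamond A$ with $r\in\mathbb{R}_{>0}$. Negation: $\overline{x}$ for $x$, $\overline{\overline{x}}=x$, $\overline{0}=0$, $\overline 1$ for $1$, $\overline{\overline{1}}=1$, $\overline{A+B}=\overline A+\overline B$, $\overline{rA}=r\overline A$, $\overline{A\sqcup B}=\overline A\sqcap\overline B$, $\overline{A\sqcap B}=\overline A\sqcup\overline B$, $\overline{\Diamond A}=\Diamond\overline A$. A weighted term is $r.A$ ($r>0$); a sequent $\vdash\Gamma$ has $\Gamma$ a finite (possibly empty) multiset of weighted terms; a hypersequent is a nonempty finite multiset of sequents $\vdash\Gamma_1\mid\cdots\mid\vdash\Gamma_n$; $G\mid\vdash\Gamma$ adds a sequent. For a finite (possibly empty) sequence $\vec r=(r_1,\dots,r_n)$ of positive reals, $\vec r.A$ is the multiset $r_1.A,\dots,r_n.A$, $\sum\vec r=r_1+\dots+r_n$, $s\vec r=(sr_1,\dots,sr_n)$; $s.\Gamma$ multiplies all weights by $s>0$; if $\Gamma=r_1.A_1,\dots,r_n.A_n$ then $\Diamond\Gamma=r_1.\Diamond A_1,\dots,r_n.\Diamond A_n$. The calculus $\mathbf{HMR}$ has the rules: INIT: $\vdash$ with no premises. W: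 from $G$ infer $G\mid\vdash\Gamma$. C: from $G\mid\vdash\Gamma\mid\vdash\Gamma$ infer $G\mid\vdash\Gamma$. S: from $G\mid\vdash\Gamma_1,\Gamma_2$ infer $G\mid\vdash\Gamma_1\mid\vdash\Gamma_2$. M: from $G\mid\vdash\Gamma_1$ and $G\mid\vdash\Gamma_2$ infer $G\mid\vdash\Gamma_1,\Gamma_2$. T: for $r>0$, from $G\mid\vdash r.\Gamma$ infer $G\mid\vdash\Gamma$. ID: if $\sum\vec r=\sum\vec s$, from $G\mid\vdash\Gamma$ infer $G\mid\vdash\Gamma,\vec r.x,\vec s.\overline{x}$ ($x$ a variable). 0: from $G\mid\vdash\Gamma$ infer $G\mid\vdash\Gamma,\vec r.0$. $+$: from $G\mid\vdash\Gamma,\vec r.A,\vec r.B$ infer $G\mid\vdash\Gamma,\vec r.(A+B)$. $\times$: from $G\mid\vdash\Gamma,(s\vec r).A$ infer $G\mid\vdash\Gamma,\vec r.(sA)$. $\sqcup$: from $G\mid\vdash\Gamma,\vec r.A\mid\vdash\Gamma,\vec r.B$ infer $G\mid\vdash\Gamma,\vec r.(A\sqcup B)$. $\sqcap$: from $G\mid\vdash\Gamma,\vec r.A$ and $G\mid\vdash\Gamma,\vec r.B$ infer $G\mid\vdash\Gamma,\vec r.(A\sqcap B)$. CAN: if $\sum\vec r=\sum\vec s$, from $G\mid\vdash\Gamma,\vec s.A,\vec r.\overline A$ infer $G\mid\vdash\Gamma$. 1: if $\sum\vec r\geq\sum\vec s$, from $G\mid\vdash\Gamma$ infer $G\mid\vdash\Gamma,\vec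 r.1,\vec s.\overline{1}$. $\Diamond$: if $\sum\vec r\geq\sum\vec s$, from the single-sequent hypersequent $\vdash\Gamma,\vec r.1,\vec s.\overline 1$ infer the single-sequent hypersequent $\vdash\Diamond\Gamma,\vec r.1,\vec s.\overline 1$. A derivation is a finite tree of rule instances whose leaves are INIT; it is CAN-free (resp. M-free) if it contains no instance of CAN (resp. M). *)

theory Defs
  imports Complex_Main "HOL-Library.Multiset" "HOL-Library.Countable"
begin

text \<open>Scalars and weights are strictly positive, so positivity is put into the type.\<close>

typedef pos_real = "{r :: real. r > 0}"
  morphisms real_of_pos pos_of_real
  by (rule exI[of _ 1]) simp

setup_lifting type_definition_pos_real

instantiation pos_real :: times
begin

lift_definition times_pos_real :: "pos_real \<Rightarrow> pos_real \<Rightarrow> pos_real" is "(*)"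
  by simp

instance ..

end

datatype 'v trm =
    Var 'v
  | NVar 'v
  | Zero
  | One
  | NOne
  | Plus "'v trm" "'v trm"
  | Scale pos_real "'v trm"
  | Join "'v trm" "'v trm"
  | Meet "'v trm" "'v trm"
  | Dia "'v trm"

primrec neg :: "'v trm \<Rightarrow> 'v trm" where
  "neg (Var x) = NVar x"
| "neg (NVar x) = Var x"
| "neg Zero = Zero"
| "neg One = NOne"
| "neg NOne = One"
| "neg (Plus A B) = Plus (neg A) (neg B)"
| "neg (Scale r A) = Scale r (neg A)"
| "neg (Join A B) = Meet (neg A) (neg B)"
| "neg (Meet A B) = Join (neg A) (neg B)"
| "neg (Dia A) = Dia (neg A)"

type_synonym 'v sequent = "(pos_real \<times> 'v trm) multiset"

text \<open>
  Hypersequents are nonempty. The type below also contains the empty multiset, which occurs in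
  rule instances only as a side context \<open>G\<close>; lemma \<open>concl_nonempty\<close> shows that every conclusion
  of a derivation is nonempty.
\<close>

type_synonym 'v hypersequent = "'v sequent multiset"

definition wsum :: "pos_real list \<Rightarrow> real" where
  "wsum rs = (\<Sum>r\<leftarrow>rs. real_of_pos r)"

definition wcopies :: "pos_real list \<Rightarrow> 'v trm \<Rightarrow> 'v sequent" (infix "\<cdot>" 75) where
  "rs \<cdot> A = mset (map (\<lambda>r. (r, A)) rs)"

definition scale_seq :: "pos_real \<Rightarrow> 'v sequent \<Rightarrow> 'v sequent" where
  "scale_seq s \<Gamma> = {# (s * r, A). (r, A) \<in># \<Gamma> #}"

definition dia_seq :: "'v sequent \<Rightarrow> 'v sequent" where
  "dia_seq \<Gamma> = {# (r, Dia A). (r, A) \<in># \<Gamma> #}"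

datatype hmr_rule =
    R_INIT | R_W | R_C | R_S | R_M | R_T | R_ID | R_Zero | R_Plus | R_Times
  | R_Join | R_Meet | R_CAN | R_One | R_Dia

text \<open>
  \<open>hmr_inst \<rho> Ps H\<close>: there is an instance of rule \<open>\<rho>\<close> with list of premises \<open>Ps\<close> and conclusion
  \<open>H\<close>. The weight lists \<open>rs\<close> and \<open>ss\<close> may be empty everywhere.
\<close>

inductive hmr_inst :: "hmr_rule \<Rightarrow> 'v hypersequent list \<Rightarrow> 'v hypersequent \<Rightarrow> bool" where
  INIT: "hmr_inst R_INIT [] {# {#} #}"
| W: "G \<noteq> {#} \<Longrightarrow> hmr_inst R_W [G] (G + {# \<Gamma> #})"
| C: "hmr_inst R_C [G + {# \<Gamma>, \<Gamma> #}] (G + {# \<Gamma> #})"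
| S: "hmr_inst R_S [G + {# \<Gamma>\<^sub>1 + \<Gamma>\<^sub>2 #}] (G + {# \<Gamma>\<^sub>1, \<Gamma>\<^sub>2 #})"
| M: "hmr_inst R_M [G + {# \<Gamma>\<^sub>1 #}, G + {# \<Gamma>\<^sub>2 #}] (G + {# \<Gamma>\<^sub>1 + \<Gamma>\<^sub>2 #})"
| T: "hmr_inst R_T [G + {# scale_seq r \<Gamma> #}] (G + {# \<Gamma> #})"
| ID: "wsum rs = wsum ss \<Longrightarrow>
    hmr_inst R_ID [G + {# \<Gamma> #}] (G + {# \<Gamma> + rs \<cdot> Var x + ss \<cdot> NVar x #})"
| Zero: "hmr_inst R_Zero [G + {# \<Gamma> #}] (G + {# \<Gamma> + rs \<cdot> Zero #})"
| Plus: "hmr_inst R_Plus [G + {# \<Gamma> + rs \<cdot> A + rs \<cdot> B #}] (G + {# \<Gamma> + rs \<cdot> Plus A B #})"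
| Times: "hmr_inst R_Times [G + {# \<Gamma> + map ((*) s) rs \<cdot> A #}] (G + {# \<Gamma> + rs \<cdot> Scale s A #})"
| Join: "hmr_inst R_Join [G + {# \<Gamma> + rs \<cdot> A, \<Gamma> + rs \<cdot> B #}] (G + {# \<Gamma> + rs \<cdot> Join A B #})"
| Meet: "hmr_inst R_Meet [G + {# \<Gamma> + rs \<cdot> A #}, G + {# \<Gamma> + rs \<cdot> B #}]
    (G + {# \<Gamma> + rs \<cdot> Meet A B #})"
| CAN: "wsum rs = wsum ss \<Longrightarrow>
    hmr_inst R_CAN [G + {# \<Gamma> + ss \<cdot> A + rs \<cdot> neg A #}] (G + {# \<Gamma> #})"
| One: "wsum rs \<ge> wsum ss \<Longrightarrow>
    hmr_inst R_One [G + {# \<Gamma> #}] (G + {# \<Gamma> + rs \<cdot> One + ss \<cdot> NOne #})"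
| Dia: "wsum rs \<ge> wsum ss \<Longrightarrow>
    hmr_inst R_Dia [{# \<Gamma> + rs \<cdot> One + ss \<cdot> NOne #}] {# dia_seq \<Gamma> + rs \<cdot> One + ss \<cdot> NOne #}"

text \<open>Finite trees whose nodes carry a rule name and the hypersequent concluded there.\<close>

datatype 'v dtree = Node hmr_rule "'v hypersequent" "'v dtree list"

primrec concl :: "'v dtree \<Rightarrow> 'v hypersequent" where
  "concl (Node \<rho> H ds) = H"

fun derivation :: "'v dtree \<Rightarrow> bool" where
  "derivation (Node \<rho> H ds) \<longleftrightarrow> hmr_inst \<rho> (map concl ds) H \<and> (\<forall>d \<in> set ds. derivation d)"

fun uses_rule :: "hmr_rule \<Rightarrow> 'v dtree \<Rightarrow> bool" where
  "uses_rule \<rho> (Node \<rho>' H ds) \<longleftrightarrow> \<rho>' = \<rho> \<or> (\<exists>d \<in> set ds. uses_rule \<rho> d)"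

definition CAN_free :: "'v dtree \<Rightarrow> bool" where
  "CAN_free d \<longleftrightarrow> \<not> uses_rule R_CAN d"

definition M_free :: "'v dtree \<Rightarrow> bool" where
  "M_free d \<longleftrightarrow> \<not> uses_rule R_M d"

lemma concl_nonempty: "derivation d \<Longrightarrow> concl d \<noteq> {#}"
  by (cases d) (auto elim: hmr_inst.cases)

end

(*
  Say that a sequent is multiplied by a list ss of weights if it is replaced by the sum of its
  scalings by the members of ss. To merge a derivation of a hypersequent with a derivation of
  G | E, replace each sequent Gamma of the first one by ss * Gamma + ts * E, where the lists vary
  from sequent to sequent, and keep G on the side. All rules except INIT and Dia survive: the only
  interesting case is S, where the lists of the two sequents are made to agree by contracting,
  scaling and splitting. INIT becomes G | ts * E. The rule Dia allows no context, so at an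
  instance of it the roles are exchanged and its conclusion is merged into the derivation of
  G | E; there two instances of Dia finally meet, and they combine to one instance below a merge of
  their premises, which exists by induction.
*)

theory Submission imports Defs begin

section \<open>Multiplication of a sequent by a list of weights\<close>

text \<open>The unit makes \<open>[1]\<close> the list that fixes every sequent; commutativity lets
  two multiplications be interchanged.\<close>

instantiation pos_real :: comm_monoid_mult
begin

lift_definition one_pos_real :: pos_real is 1
  by simp

instance
  by standard (transfer, simp)+

end

lemma wsum_simps [simp]:
  "wsum [] = 0" "wsum (r # rs) = real_of_pos r + wsum rs" "wsum (rs @ ss) = wsum rs + wsum ss"
  by (simp_all add: wsum_def)

lemma wsum_nonneg: "0 \<le> wsum rs"
  using real_of_pos by (auto simp: wsum_def less_imp_le intro!: sum_list_nonneg)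

lemma wsum_map_times: "wsum (map ((*) s) rs) = real_of_pos s * wsum rs"
  by (induction rs) (simp_all add: times_pos_real.rep_eq algebra_simps)

lemma wcopies_Nil [simp]: "[] \<cdot> A = {#}"
  by (simp add: wcopies_def)

lemma wcopies_append: "(rs @ ss) \<cdot> A = rs \<cdot> A + ss \<cdot> A"
  by (simp add: wcopies_def)

lemma scale_seq_empty [simp]: "scale_seq s {#} = {#}"
  by (simp add: scale_seq_def)

lemma scale_seq_plus: "scale_seq s (\<Gamma> + \<Delta>) = scale_seq s \<Gamma> + scale_seq s \<Delta>"
  by (simp add: scale_seq_def)

lemma scale_seq_wcopies: "scale_seq s (rs \<cdot> A) = map ((*) s) rs \<cdot> A"
  by (simp add: scale_seq_def wcopies_def mset_map multiset.map_comp comp_def)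

lemma scale_seq_scale_seq: "scale_seq s (scale_seq t \<Gamma>) = scale_seq (s * t) \<Gamma>"
  by (simp add: scale_seq_def multiset.map_comp comp_def split_def mult.assoc)

lemma scale_seq_1 [simp]: "scale_seq 1 \<Gamma> = \<Gamma>"
  by (simp add: scale_seq_def)

lemma dia_seq_plus: "dia_seq (\<Gamma> + \<Delta>) = dia_seq \<Gamma> + dia_seq \<Delta>"
  by (simp add: dia_seq_def)

lemma dia_seq_scale_seq: "dia_seq (scale_seq s \<Gamma>) = scale_seq s (dia_seq \<Gamma>)"
  by (simp add: dia_seq_def scale_seq_def multiset.map_comp comp_def split_def)

text \<open>Lists act in place of single weights because a multiset does not add the weights of
  equal terms: several copies of a nonempty sequent are not a scaling of it. The empty list erases
  the sequent.\<close>

definition list_scale :: "pos_real list \<Rightarrow> 'v sequent \<Rightarrow> 'v sequent" (infixr "\<odot>" 72) where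
  "ss \<odot> \<Gamma> = (\<Sum>s\<leftarrow>ss. scale_seq s \<Gamma>)"

definition weight_prod :: "pos_real list \<Rightarrow> pos_real list \<Rightarrow> pos_real list" where
  "weight_prod ss ts = concat (map (\<lambda>s. map ((*) s) ts) ss)"

lemma list_scale_simps [simp]:
  "[] \<odot> \<Gamma> = {#}" "(s # ss) \<odot> \<Gamma> = scale_seq s \<Gamma> + ss \<odot> \<Gamma>" "ss \<odot> {#} = {#}"
  by (simp_all add: list_scale_def)

lemma list_scale_append: "(ss @ ts) \<odot> \<Gamma> = ss \<odot> \<Gamma> + ts \<odot> \<Gamma>"
  by (simp add: list_scale_def)

lemma list_scale_plus: "ss \<odot> (\<Gamma> + \<Delta>) = ss \<odot> \<Gamma> + ss \<odot> \<Delta>"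
  by (induction ss) (simp_all add: scale_seq_plus)

lemma list_scale_map: "map ((*) s) ss \<odot> \<Gamma> = scale_seq s (ss \<odot> \<Gamma>)"
  by (induction ss) (simp_all add: scale_seq_plus scale_seq_scale_seq)

lemma list_scale_scale_seq: "ss \<odot> scale_seq s \<Gamma> = scale_seq s (ss \<odot> \<Gamma>)"
  by (induction ss) (simp_all add: scale_seq_plus scale_seq_scale_seq mult.commute)

lemma list_scale_weight_prod: "weight_prod ss ts \<odot> \<Gamma> = ss \<odot> ts \<odot> \<Gamma>"
  by (induction ss) (simp_all add: weight_prod_def list_scale_append list_scale_map)

lemma list_scale_commute: "ss \<odot> ts \<odot> \<Gamma> = ts \<odot> ss \<odot> \<Gamma>"
  by (induction ss) (simp_all add: list_scale_plus list_scale_scale_seq)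

text \<open>The multiple of a block \<open>rs \<cdot> A\<close> is again one block. As the rules act
  on whole weight vectors, one instance still suffices after multiplication.\<close>

lemma list_scale_wcopies: "ss \<odot> (rs \<cdot> A) = weight_prod ss rs \<cdot> A"
  by (induction ss) (simp_all add: weight_prod_def wcopies_append scale_seq_wcopies)

text \<open>Both sides of the side conditions of ID, 1 and the diamond rule get the same nonnegative
  factor, so the conditions survive multiplication.\<close>

lemma wsum_weight_prod: "wsum (weight_prod ss ts) = wsum ss * wsum ts"
  by (induction ss) (simp_all add: weight_prod_def wsum_map_times algebra_simps)

lemma weight_prod_map: "weight_prod ss (map ((*) s) rs) = map ((*) s) (weight_prod ss rs)"
  by (induction ss) (simp_all add: weight_prod_def mult.left_commute)

lemma dia_seq_list_scale: "dia_seq (ss \<odot> \<Gamma>) = ss \<odot> dia_seq \<Gamma>"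
  by (induction ss) (simp_all add: dia_seq_plus dia_seq_scale_seq, simp add: dia_seq_def)

section \<open>Provability without CAN and M\<close>

inductive provable :: "'v hypersequent \<Rightarrow> bool" where
  step: "hmr_inst \<rho> Ps H \<Longrightarrow> \<rho> \<notin> {R_CAN, R_M} \<Longrightarrow> (\<And>P. P \<in> set Ps \<Longrightarrow> provable P) \<Longrightarrow> provable H"

lemma provable_imp_derivation:
  assumes "provable H"
  shows "\<exists>d. derivation d \<and> concl d = H \<and> CAN_free d \<and> M_free d"
  using assms
proof induction
  case (step \<rho> Ps H)
  then obtain f where f: "\<And>P. P \<in> set Ps \<Longrightarrow>
      derivation (f P) \<and> concl (f P) = P \<and> CAN_free (f P) \<and> M_free (f P)"
    by metis
  then have "map concl (map f Ps) = Ps"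
    by (simp add: map_idI)
  with f step.hyps show ?case
    by (intro exI[of _ "Node \<rho> H (map f Ps)"]) (auto simp: CAN_free_def M_free_def)
qed

lemma provable_nonempty: "provable H \<Longrightarrow> H \<noteq> {#}"
  using provable_imp_derivation concl_nonempty by blast

lemma provable_INIT: "provable {#{#}#}"
  by (rule provable.step[OF hmr_inst.INIT]) auto

lemma provable_W: "provable G \<Longrightarrow> provable (add_mset \<Gamma> G)"
  \<comment> \<open>W demands a nonempty context, which provability of \<open>G\<close>
    guarantees.\<close>
  using provable.step[OF hmr_inst.W[of G \<Gamma>]] provable_nonempty by auto

lemma provable_weaken: "provable G \<Longrightarrow> provable (G + H)"
  by (induction H) (auto intro: provable_W)

lemma provable_C: "provable (add_mset \<Gamma> (add_mset \<Gamma> G)) \<Longrightarrow> provable (add_mset \<Gamma> G)"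
  using provable.step[OF hmr_inst.C[of G \<Gamma>]] by auto

lemma provable_S:
  "provable (add_mset (\<Gamma> + \<Delta>) G) \<Longrightarrow> provable (add_mset \<Gamma> (add_mset \<Delta> G))"
  using provable.step[OF hmr_inst.S[of G \<Gamma> \<Delta>]] by auto

lemma provable_T: "provable (add_mset (scale_seq r \<Gamma>) G) \<Longrightarrow> provable (add_mset \<Gamma> G)"
  using provable.step[OF hmr_inst.T[of G r \<Gamma>]] by auto

lemma provable_ID:
  "wsum rs = wsum ss \<Longrightarrow> provable (add_mset \<Gamma> G) \<Longrightarrow>
    provable (add_mset (\<Gamma> + rs \<cdot> Var x + ss \<cdot> NVar x) G)"
  using provable.step[OF hmr_inst.ID[of rs ss G \<Gamma> x]] by auto

lemma provable_Zero: "provable (add_mset \<Gamma> G) \<Longrightarrow> provable (add_mset (\<Gamma> + rs \<cdot> Zero) G)"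
  using provable.step[OF hmr_inst.Zero[of G \<Gamma> rs]] by auto

lemma provable_Plus:
  "provable (add_mset (\<Gamma> + rs \<cdot> A + rs \<cdot> B) G) \<Longrightarrow> provable (add_mset (\<Gamma> + rs \<cdot> Plus A B) G)"
  using provable.step[OF hmr_inst.Plus[of G \<Gamma> rs A B]] by auto

lemma provable_Times:
  "provable (add_mset (\<Gamma> + map ((*) s) rs \<cdot> A) G) \<Longrightarrow> provable (add_mset (\<Gamma> + rs \<cdot> Scale s A) G)"
  using provable.step[OF hmr_inst.Times[of G \<Gamma> s rs A]] by auto

lemma provable_Join:
  "provable (add_mset (\<Gamma> + rs \<cdot> A) (add_mset (\<Gamma> + rs \<cdot> B) G)) \<Longrightarrow>
    provable (add_mset (\<Gamma> + rs \<cdot> Join A B) G)"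
  using provable.step[OF hmr_inst.Join[of G \<Gamma> rs A B]] by auto

lemma provable_Meet:
  "provable (add_mset (\<Gamma> + rs \<cdot> A) G) \<Longrightarrow> provable (add_mset (\<Gamma> + rs \<cdot> B) G) \<Longrightarrow>
    provable (add_mset (\<Gamma> + rs \<cdot> Meet A B) G)"
  using provable.step[OF hmr_inst.Meet[of G \<Gamma> rs A B]] by auto

lemma provable_One:
  "wsum rs \<ge> wsum ss \<Longrightarrow> provable (add_mset \<Gamma> G) \<Longrightarrow>
    provable (add_mset (\<Gamma> + rs \<cdot> One + ss \<cdot> NOne) G)"
  using provable.step[OF hmr_inst.One[of ss rs G \<Gamma>]] by auto

lemma provable_Dia:
  "wsum rs \<ge> wsum ss \<Longrightarrow> provable {#\<Gamma> + rs \<cdot> One + ss \<cdot> NOne#} \<Longrightarrow>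
    provable {#dia_seq \<Gamma> + rs \<cdot> One + ss \<cdot> NOne#}"
  using provable.step[OF hmr_inst.Dia[of ss rs \<Gamma>]] by auto

text \<open>C is applied to the members of \<open>G\<close> in turn. This will remove the second
  copy of the context left by a merge of the two premises of M.\<close>

lemma provable_contract: "provable (G + G + H) \<Longrightarrow> provable (G + H)"
proof (induction G arbitrary: H)
  case (add \<Gamma> G)
  have "provable (G + G + add_mset \<Gamma> H)"
    using add.prems by (auto intro: provable_C)
  from add.IH[OF this] show ?case
    by simp
qed simp

text \<open>S splits the multiple into its scalings, T turns each of them into
  \<open>\<Gamma>\<close>, and C identifies the copies. With \<open>ss = []\<close> there would be
  no copy to start from.\<close>

lemma provable_unscale:
  assumes "provable (add_mset (ss \<odot> \<Gamma>) G)" and "ss \<noteq> []"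
  shows "provable (add_mset \<Gamma> G)"
  using assms(2,1)
proof (induction ss arbitrary: G rule: list_nonempty_induct)
  case (single s)
  then show ?case
    by (auto intro: provable_T)
next
  case (cons s ss)
  have "provable (add_mset \<Gamma> (add_mset (ss \<odot> \<Gamma>) G))"
    using cons.prems by (auto intro: provable_T provable_S)
  then have "provable (add_mset (ss \<odot> \<Gamma>) (add_mset \<Gamma> G))"
    by (simp add: add_mset_commute)
  from cons.IH[OF this] show ?case
    by (rule provable_C)
qed

section \<open>Merging derivations\<close>

text \<open>INIT and the diamond rule have no side context, so a merge cannot pass through them.
  Their conclusions are single sequents and enter as leaves instead.\<close>

inductive derivable_from :: "'v sequent set \<Rightarrow> 'v hypersequent \<Rightarrow> bool" for L where
  leaf: "\<Delta> \<in> L \<Longrightarrow> derivable_from L {#\<Delta>#}"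
| step: "hmr_inst \<rho> Ps H \<Longrightarrow> \<rho> \<notin> {R_INIT, R_CAN, R_M, R_Dia} \<Longrightarrow>
    (\<And>P. P \<in> set Ps \<Longrightarrow> derivable_from L P) \<Longrightarrow> derivable_from L H"

text \<open>The lists are quantified inside the relation, so under \<open>rel_mset\<close> each
  sequent has its own pair. Either list may be empty.\<close>

definition combines :: "'v sequent \<Rightarrow> 'v sequent \<Rightarrow> 'v sequent \<Rightarrow> bool" where
  "combines E \<Gamma> \<Gamma>' \<longleftrightarrow> (\<exists>ss ts. \<Gamma>' = ss \<odot> \<Gamma> + ts \<odot> E)"

lemma combinesI: "combines E \<Gamma> (ss \<odot> \<Gamma> + ts \<odot> E)"
  by (auto simp: combines_def)

lemma combines_refl: "combines E \<Gamma> \<Gamma>"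
  using combinesI[of E \<Gamma> "[1]" "[]"] by simp

lemma rel_mset_combines_refl: "rel_mset (combines E) H H"
  by (simp add: multiset.rel_refl combines_refl)

text \<open>Induction for all \<open>H'\<close> at once, so that each case may choose the lists in
  its premises. The assumption on multiples of \<open>E\<close> serves S, where a component may have
  lost its share of the original sequent.\<close>

lemma derivable_from_merge:
  assumes "derivable_from L H"
    and E: "\<And>ts. provable (add_mset (ts \<odot> E) G)"
    and L: "\<And>\<Delta> ss ts. \<Delta> \<in> L \<Longrightarrow> provable (add_mset (ss \<odot> \<Delta> + ts \<odot> E) G)"
    and "rel_mset (combines E) H H'"
  shows "provable (H' + G)"
  using assms(1,4)
proof (induction arbitrary: H')
  case (leaf \<Delta>)
  then show ?case
    using L by (auto simp: combines_def dest!: msed_rel_invL)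
next
  case (step \<rho> Ps H)
  have inv: "\<exists>F' ss ts. H' = add_mset (ss \<odot> \<Gamma> + ts \<odot> E) F' \<and> rel_mset (combines E) F F'"
    if "H = add_mset \<Gamma> F" for \<Gamma> F
    using step.prems that msed_rel_invL[of "combines E" \<Gamma> F H']
    by (auto simp: combines_def[of E \<Gamma>])
  have IH: "provable (add_mset (ss \<odot> \<Gamma> + ts \<odot> E) (F' + G))"
    if "add_mset \<Gamma> F \<in> set Ps" and "rel_mset (combines E) F F'" for \<Gamma> F F' ss ts
    using step.IH[OF that(1) rel_mset_Plus[OF combinesI that(2)]] by simp
  \<comment> \<open>Both active sequents receive the same lists, as C and the join rule
    require.\<close>
  have IH2: "provable (add_mset (ss \<odot> \<Gamma> + ts \<odot> E) (add_mset (ss \<odot> \<Gamma>\<^sub>2 + ts \<odot> E) (F' + G)))"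
    if "add_mset \<Gamma> (add_mset \<Gamma>\<^sub>2 F) \<in> set Ps" and "rel_mset (combines E) F F'" for \<Gamma> \<Gamma>\<^sub>2 F F' ss ts
    using step.IH[OF that(1) rel_mset_Plus[OF combinesI rel_mset_Plus[OF combinesI that(2)]]] by simp
  note scale_simps = list_scale_plus list_scale_wcopies weight_prod_map
  from step.hyps show ?case
  proof (cases rule: hmr_inst.cases)
    case (W F \<Gamma>)
    then obtain F' ss ts where H': "H' = add_mset (ss \<odot> \<Gamma> + ts \<odot> E) F'"
      and "rel_mset (combines E) F F'"
      using inv[of \<Gamma> F] by auto
    with step.IH[of F] W have "provable (F' + G)"
      by simp
    then show ?thesis
      unfolding H' by (simp add: provable_W)
  next
    case (C F \<Gamma>)
    then obtain F' ss ts where H': "H' = add_mset (ss \<odot> \<Gamma> + ts \<odot> E) F'"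
      and F': "rel_mset (combines E) F F'"
      using inv[of \<Gamma> F] by auto
    with IH2[OF _ F'] C show ?thesis
      by (simp add: provable_C)
  next
    case (S F \<Gamma>\<^sub>1 \<Gamma>\<^sub>2)
    then obtain F1 ss1 ts1 where F1: "H' = add_mset (ss1 \<odot> \<Gamma>\<^sub>1 + ts1 \<odot> E) F1"
        "rel_mset (combines E) (add_mset \<Gamma>\<^sub>2 F) F1"
      using inv[of \<Gamma>\<^sub>1 "add_mset \<Gamma>\<^sub>2 F"] by auto
    then obtain F' ss2 ts2 where F2: "F1 = add_mset (ss2 \<odot> \<Gamma>\<^sub>2 + ts2 \<odot> E) F'"
      and F': "rel_mset (combines E) F F'"
      by (auto simp: combines_def dest!: msed_rel_invL)
    let ?\<Delta>1 = "ss1 \<odot> \<Gamma>\<^sub>1 + ts1 \<odot> E" and ?\<Delta>2 = "ss2 \<odot> \<Gamma>\<^sub>2 + ts2 \<odot> E"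
    have H': "H' + G = add_mset ?\<Delta>1 (add_mset ?\<Delta>2 (F' + G))"
      by (simp add: F1 F2)
    \<comment> \<open>An empty list cannot be undone by \<open>provable_unscale\<close>. In that
      case the component is a multiple of \<open>E\<close> alone, provable beside \<open>G\<close>,
      and weakening adds the rest.\<close>
    consider "ss1 = []" | "ss2 = []" | "ss1 \<noteq> []" "ss2 \<noteq> []"
      by blast
    then show ?thesis
    proof cases
      case 1
      then have "provable (add_mset ?\<Delta>1 G + add_mset ?\<Delta>2 F')"
        using E by (intro provable_weaken) simp
      then show ?thesis
        unfolding H' by (subst add_mset_commute) (simp add: ac_simps)
    next
      case 2
      then have "provable (add_mset ?\<Delta>2 G + add_mset ?\<Delta>1 F')"
        using E by (intro provable_weaken) simp
      then show ?thesis
        unfolding H' by (subst add_mset_commute) (simp add: ac_simps)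
    next
      case 3
      \<comment> \<open>Cross-multiplication: the product of \<open>ss1\<close> and
        \<open>ss2\<close> is a common list for both parts of the premise, and the list for
        \<open>E\<close> is chosen so that the sequent splits into
        \<open>ss2 \<odot> ?\<Delta>1\<close> and \<open>ss1 \<odot> ?\<Delta>2\<close>.\<close>
      have "provable (add_mset (weight_prod ss2 ss1 \<odot> (\<Gamma>\<^sub>1 + \<Gamma>\<^sub>2) +
          (weight_prod ss2 ts1 @ weight_prod ss1 ts2) \<odot> E) (F' + G))"
        using IH[OF _ F'] S by simp
      moreover have "weight_prod ss2 ss1 \<odot> (\<Gamma>\<^sub>1 + \<Gamma>\<^sub>2) +
          (weight_prod ss2 ts1 @ weight_prod ss1 ts2) \<odot> E = ss2 \<odot> ?\<Delta>1 + ss1 \<odot> ?\<Delta>2"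
        by (simp add: list_scale_plus list_scale_weight_prod list_scale_append
            list_scale_commute[of ss2 ss1 \<Gamma>\<^sub>2])
      ultimately have "provable (add_mset (ss2 \<odot> ?\<Delta>1) (add_mset (ss1 \<odot> ?\<Delta>2) (F' + G)))"
        by (simp add: provable_S)
      then have "provable (add_mset ?\<Delta>1 (add_mset (ss1 \<odot> ?\<Delta>2) (F' + G)))"
        using 3 by (blast intro: provable_unscale)
      then have "provable (add_mset (ss1 \<odot> ?\<Delta>2) (add_mset ?\<Delta>1 (F' + G)))"
        by (subst add_mset_commute)
      then have "provable (add_mset ?\<Delta>2 (add_mset ?\<Delta>1 (F' + G)))"
        using 3 by (blast intro: provable_unscale)
      then show ?thesis
        unfolding H' by (subst add_mset_commute)
    qed
  next
    case (T F r \<Gamma>)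
    then obtain F' ss ts where H': "H' = add_mset (ss \<odot> \<Gamma> + ts \<odot> E) F'"
      and F': "rel_mset (combines E) F F'"
      using inv[of \<Gamma> F] by auto
    \<comment> \<open>The \<open>E\<close> part of the premise is scaled by \<open>r\<close> as
      well, so that \<open>r\<close> factors out of the whole sequent.\<close>
    have "provable (add_mset (ss \<odot> scale_seq r \<Gamma> + map ((*) r) ts \<odot> E) (F' + G))"
      using IH[OF _ F'] T by simp
    then have "provable (add_mset (scale_seq r (ss \<odot> \<Gamma> + ts \<odot> E)) (F' + G))"
      by (simp add: list_scale_scale_seq list_scale_map scale_seq_plus)
    then show ?thesis
      unfolding H' by (simp add: provable_T)
  next
    case (ID rs us F \<Gamma> x)
    then obtain F' ss ts
      where H': "H' = add_mset (ss \<odot> (\<Gamma> + rs \<cdot> Var x + us \<cdot> NVar x) + ts \<odot> E) F'"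
      and F': "rel_mset (combines E) F F'"
      using inv[of "\<Gamma> + rs \<cdot> Var x + us \<cdot> NVar x" F] by auto
    have "provable (add_mset (ss \<odot> \<Gamma> + ts \<odot> E) (F' + G))"
      using IH[OF _ F'] ID by simp
    from provable_ID[OF _ this, of "weight_prod ss rs" "weight_prod ss us" x] ID
    show ?thesis
      by (simp add: H' scale_simps wsum_weight_prod ac_simps)
  next
    case (Zero F \<Gamma> rs)
    then obtain F' ss ts where H': "H' = add_mset (ss \<odot> (\<Gamma> + rs \<cdot> trm.Zero) + ts \<odot> E) F'"
      and F': "rel_mset (combines E) F F'"
      using inv[of "\<Gamma> + rs \<cdot> trm.Zero" F] by auto
    have "provable (add_mset (ss \<odot> \<Gamma> + ts \<odot> E) (F' + G))"
      using IH[OF _ F'] Zero by simp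
    from provable_Zero[OF this, of "weight_prod ss rs"] show ?thesis
      by (simp add: H' scale_simps ac_simps)
  next
    case (Plus F \<Gamma> rs A B)
    then obtain F' ss ts where H': "H' = add_mset (ss \<odot> (\<Gamma> + rs \<cdot> trm.Plus A B) + ts \<odot> E) F'"
      and F': "rel_mset (combines E) F F'"
      using inv[of "\<Gamma> + rs \<cdot> trm.Plus A B" F] by auto
    have "provable (add_mset (ss \<odot> (\<Gamma> + rs \<cdot> A + rs \<cdot> B) + ts \<odot> E) (F' + G))"
      using IH[OF _ F'] Plus by simp
    then show ?thesis
      using provable_Plus[of "ss \<odot> \<Gamma> + ts \<odot> E" "weight_prod ss rs" A B "F' + G"]
      by (simp add: H' scale_simps ac_simps)
  next
    case (Times F \<Gamma> s rs A)
    then obtain F' ss ts where H': "H' = add_mset (ss \<odot> (\<Gamma> + rs \<cdot> Scale s A) + ts \<odot> E) F'"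
      and F': "rel_mset (combines E) F F'"
      using inv[of "\<Gamma> + rs \<cdot> Scale s A" F] by auto
    have "provable (add_mset (ss \<odot> (\<Gamma> + map ((*) s) rs \<cdot> A) + ts \<odot> E) (F' + G))"
      using IH[OF _ F'] Times by simp
    then show ?thesis
      using provable_Times[of "ss \<odot> \<Gamma> + ts \<odot> E" s "weight_prod ss rs" A "F' + G"]
      by (simp add: H' scale_simps ac_simps)
  next
    case (Join F \<Gamma> rs A B)
    then obtain F' ss ts where H': "H' = add_mset (ss \<odot> (\<Gamma> + rs \<cdot> trm.Join A B) + ts \<odot> E) F'"
      and F': "rel_mset (combines E) F F'"
      using inv[of "\<Gamma> + rs \<cdot> trm.Join A B" F] by auto
    have "provable (add_mset (ss \<odot> (\<Gamma> + rs \<cdot> A) + ts \<odot> E)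
        (add_mset (ss \<odot> (\<Gamma> + rs \<cdot> B) + ts \<odot> E) (F' + G)))"
      using IH2[OF _ F'] Join by simp
    then show ?thesis
      using provable_Join[of "ss \<odot> \<Gamma> + ts \<odot> E" "weight_prod ss rs" A B "F' + G"]
      by (simp add: H' scale_simps ac_simps)
  next
    case (Meet F \<Gamma> rs A B)
    then obtain F' ss ts where H': "H' = add_mset (ss \<odot> (\<Gamma> + rs \<cdot> trm.Meet A B) + ts \<odot> E) F'"
      and F': "rel_mset (combines E) F F'"
      using inv[of "\<Gamma> + rs \<cdot> trm.Meet A B" F] by auto
    have "provable (add_mset (ss \<odot> (\<Gamma> + rs \<cdot> A) + ts \<odot> E) (F' + G))"
      "provable (add_mset (ss \<odot> (\<Gamma> + rs \<cdot> B) + ts \<odot> E) (F' + G))"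
      using IH[OF _ F'] Meet by simp_all
    then show ?thesis
      using provable_Meet[of "ss \<odot> \<Gamma> + ts \<odot> E" "weight_prod ss rs" A "F' + G" B]
      by (simp add: H' scale_simps ac_simps)
  next
    case (One rs us F \<Gamma>)
    then obtain F' ss ts
      where H': "H' = add_mset (ss \<odot> (\<Gamma> + rs \<cdot> trm.One + us \<cdot> NOne) + ts \<odot> E) F'"
      and F': "rel_mset (combines E) F F'"
      using inv[of "\<Gamma> + rs \<cdot> trm.One + us \<cdot> NOne" F] by auto
    have "provable (add_mset (ss \<odot> \<Gamma> + ts \<odot> E) (F' + G))"
      using IH[OF _ F'] One by simp
    moreover have "wsum (weight_prod ss us) \<le> wsum (weight_prod ss rs)"
      using One by (simp add: wsum_weight_prod mult_left_mono wsum_nonneg)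
    ultimately show ?thesis
      using provable_One[of "weight_prod ss us" "weight_prod ss rs" "ss \<odot> \<Gamma> + ts \<odot> E" "F' + G"]
      by (simp add: H' scale_simps ac_simps)
  qed auto
qed

section \<open>Derivations cut at INIT and at the diamond rule\<close>

inductive_set leaf_sequents :: "('v sequent \<Rightarrow> bool) \<Rightarrow> 'v sequent set" for Q where
  empty: "{#} \<in> leaf_sequents Q"
| dia: "wsum rs \<ge> wsum ss \<Longrightarrow> provable {#\<Gamma> + rs \<cdot> One + ss \<cdot> NOne#} \<Longrightarrow>
    Q (\<Gamma> + rs \<cdot> One + ss \<cdot> NOne) \<Longrightarrow> dia_seq \<Gamma> + rs \<cdot> One + ss \<cdot> NOne \<in> leaf_sequents Q"

text \<open>The derivation is cut at its lowest diamond instances. \<open>Q\<close> is the property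
  to be proved by induction on nested diamonds: for a premise of a diamond instance it may be shown
  from leaves whose own premises already satisfy it.\<close>

lemma provable_imp_derivable_from:
  assumes "provable H"
    and Q: "\<And>\<Gamma>. provable {#\<Gamma>#} \<Longrightarrow> derivable_from (leaf_sequents Q) {#\<Gamma>#} \<Longrightarrow> Q \<Gamma>"
  shows "derivable_from (leaf_sequents Q) H"
  using assms(1)
proof induction
  case (step \<rho> Ps H)
  consider "\<rho> = R_INIT" | "\<rho> = R_Dia" | "\<rho> \<notin> {R_INIT, R_CAN, R_M, R_Dia}"
    using step.hyps by blast
  then show ?case
  proof cases
    case 1
    with step.hyps show ?thesis
      by (auto elim!: hmr_inst.cases intro: derivable_from.leaf leaf_sequents.empty)
  next
    case 2
    with step.hyps obtain rs ss \<Gamma> where dia: "wsum rs \<ge> wsum ss"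
      "Ps = [{#\<Gamma> + rs \<cdot> One + ss \<cdot> NOne#}]" "H = {#dia_seq \<Gamma> + rs \<cdot> One + ss \<cdot> NOne#}"
      by (auto elim: hmr_inst.cases)
    with step show ?thesis
      by (auto intro!: derivable_from.leaf leaf_sequents.dia intro: Q)
  next
    case 3
    with step show ?thesis
      by (blast intro: derivable_from.step)
  qed
qed

text \<open>\<open>dia_seq\<close> commutes with sums and multiples, and the inequalities between
  weights of \<open>One\<close> and \<open>NOne\<close> are preserved by nonnegative combinations.
  So two diamond instances fuse into one.\<close>

lemma provable_Dia_scaled:
  assumes "wsum rs \<ge> wsum ss" "wsum rs' \<ge> wsum ss'"
    and "provable {#us \<odot> (\<Gamma> + rs \<cdot> One + ss \<cdot> NOne) + vs \<odot> (\<Gamma>' + rs' \<cdot> One + ss' \<cdot> NOne)#}"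
  shows "provable
    {#us \<odot> (dia_seq \<Gamma> + rs \<cdot> One + ss \<cdot> NOne) + vs \<odot> (dia_seq \<Gamma>' + rs' \<cdot> One + ss' \<cdot> NOne)#}"
proof -
  have "wsum (weight_prod us ss @ weight_prod vs ss') \<le> wsum (weight_prod us rs @ weight_prod vs rs')"
    using assms(1,2) by (simp add: wsum_weight_prod add_mono mult_left_mono wsum_nonneg)
  from provable_Dia[OF this, of "us \<odot> \<Gamma> + vs \<odot> \<Gamma>'"] assms(3) show ?thesis
    by (simp add: list_scale_plus list_scale_wcopies wcopies_append dia_seq_plus
        dia_seq_list_scale ac_simps)
qed

text \<open>Copies cannot be joined by M, so the multiple is obtained as a merge with the empty
  sequent in place of \<open>E\<close>. The other components keep the list
  \<open>[1]\<close>.\<close>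

lemma provable_scale:
  assumes "provable (add_mset \<Gamma> G)"
  shows "provable (add_mset (ss \<odot> \<Gamma>) G)"
proof -
  let ?Q = "\<lambda>\<Gamma> :: 'a sequent. \<forall>ss. provable {#ss \<odot> \<Gamma>#}"
  have merge: "provable H'"
    if "derivable_from (leaf_sequents ?Q) H" "rel_mset (combines {#}) H H'" for H H'
  proof -
    have "provable (H' + {#})"
      using that(1) _ _ that(2)
    proof (rule derivable_from_merge)
      fix \<Delta> :: "'a sequent" and ss ts
      assume "\<Delta> \<in> leaf_sequents ?Q"
      then show "provable {#ss \<odot> \<Delta> + ts \<odot> {#}#}"
      proof cases
        case empty
        then show ?thesis by (simp add: provable_INIT)
      next
        case (dia rs us \<Gamma>)
        then show ?thesis
          \<comment> \<open>The list \<open>[]\<close> makes the second conclusion vanish.\<close>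
          using provable_Dia_scaled[of us rs us rs ss \<Gamma> "[]"] by simp
      qed
    qed (simp add: provable_INIT)
    then show ?thesis by simp
  qed
  have "derivable_from (leaf_sequents ?Q) (add_mset \<Gamma> G)"
    using assms
  proof (rule provable_imp_derivable_from)
    fix \<Gamma> :: "'a sequent"
    assume "derivable_from (leaf_sequents ?Q) {#\<Gamma>#}"
    then show "?Q \<Gamma>"
      using merge rel_mset_Plus[OF combinesI[of "{#}" \<Gamma> _ "[]"] rel_mset_combines_refl[of _ "{#}"]]
      by auto
  qed
  then show ?thesis
    using merge rel_mset_Plus[OF combinesI[of "{#}" \<Gamma> ss "[]"] rel_mset_combines_refl] by simp
qed

text \<open>The merge property for single sequents without context: what is required when two
  diamond instances meet. It is the \<open>Q\<close> of the induction that yields M.\<close>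

definition absorbable :: "'v sequent \<Rightarrow> bool" where
  "absorbable \<Gamma> \<longleftrightarrow> (\<forall>\<Delta> ss ts. provable {#\<Delta>#} \<longrightarrow> provable {#ss \<odot> \<Gamma> + ts \<odot> \<Delta>#})"

text \<open>The exchange of roles: the conclusion of the diamond rule is merged into a derivation of
  the other hypersequent.\<close>

lemma provable_dia_merge:
  assumes "wsum rs \<ge> wsum ss"
    and prem: "provable {#\<Gamma> + rs \<cdot> One + ss \<cdot> NOne#}" "absorbable (\<Gamma> + rs \<cdot> One + ss \<cdot> NOne)"
    and E: "provable (add_mset E G)"
  shows "provable (add_mset (us \<odot> (dia_seq \<Gamma> + rs \<cdot> One + ss \<cdot> NOne) + vs \<odot> E) G)"
proof -
  let ?D = "dia_seq \<Gamma> + rs \<cdot> One + ss \<cdot> NOne"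
  have D: "provable {#ts \<odot> ?D#}" for ts
    by (intro provable_scale provable_Dia assms)
  \<comment> \<open>The trivial predicate suffices: \<open>leaf_sequents\<close> also records that
    the premise of the diamond rule is provable, which is what absorbability asks of the other
    sequent.\<close>
  have "derivable_from (leaf_sequents (\<lambda>_. True)) (add_mset E G)"
    using E by (rule provable_imp_derivable_from) simp
  \<comment> \<open>Now \<open>?D\<close> plays the part of the merged sequent, with empty side
    context, and \<open>G\<close> belongs to the hypersequent being rebuilt.\<close>
  then have "provable (add_mset (vs \<odot> E + us \<odot> ?D) G + {#})"
    using D _ rel_mset_Plus[OF combinesI rel_mset_combines_refl]
  proof (rule derivable_from_merge)
    fix \<Delta> :: "'a sequent" and ws ts
    assume "\<Delta> \<in> leaf_sequents (\<lambda>_. True)"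
    then show "provable {#ws \<odot> \<Delta> + ts \<odot> ?D#}"
    proof cases
      case empty
      then show ?thesis by (simp add: D)
    next
      case (dia rs' ss' \<Gamma>')
      have "provable {#ts \<odot> (\<Gamma> + rs \<cdot> One + ss \<cdot> NOne) + ws \<odot> (\<Gamma>' + rs' \<cdot> One + ss' \<cdot> NOne)#}"
        using prem(2) dia by (simp add: absorbable_def)
      from provable_Dia_scaled[OF assms(1) _ this] dia show ?thesis
        by (simp add: add.commute)
    qed
  qed
  then show ?thesis
    by (simp add: add.commute)
qed

text \<open>Both kinds of leaves are settled: an empty leaf leaves a multiple of \<open>E\<close>,
  and a diamond leaf is handled by exchanging roles.\<close>

lemma derivable_from_absorbable_merge:
  assumes "derivable_from (leaf_sequents absorbable) H" "provable (add_mset E G)"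
    and "rel_mset (combines E) H H'"
  shows "provable (H' + G)"
  using assms(1) _ _ assms(3)
proof (rule derivable_from_merge)
  show E: "provable (add_mset (ts \<odot> E) G)" for ts
    by (intro provable_scale assms)
  fix \<Delta> :: "'a sequent" and ss ts
  assume "\<Delta> \<in> leaf_sequents absorbable"
  then show "provable (add_mset (ss \<odot> \<Delta> + ts \<odot> E) G)"
    by cases (simp_all add: E provable_dia_merge assms)
qed

lemma provable_M:
  assumes "provable (add_mset \<Gamma> G)" "provable (add_mset \<Delta> G)"
  shows "provable (add_mset (\<Gamma> + \<Delta>) G)"
proof -
  have "derivable_from (leaf_sequents absorbable) (add_mset \<Gamma> G)"
    using assms(1)
  proof (rule provable_imp_derivable_from)
    fix \<Gamma> :: "'a sequent"
    assume der: "derivable_from (leaf_sequents absorbable) {#\<Gamma>#}"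
    \<comment> \<open>The same merge with empty context closes the induction on nested
      diamonds.\<close>
    have "provable ({#ss \<odot> \<Gamma> + ts \<odot> \<Delta>#} + {#})" if "provable {#\<Delta>#}" for \<Delta> ss ts
      by (rule derivable_from_absorbable_merge[OF der that])
        (rule rel_mset_Plus[OF combinesI rel_mset_combines_refl])
    then show "absorbable \<Gamma>"
      by (simp add: absorbable_def)
  qed
  \<comment> \<open>With both lists \<open>[1]\<close> the active sequents are added. One
    \<open>G\<close> is carried along unchanged, the other is the side context.\<close>
  from derivable_from_absorbable_merge[OF this assms(2)
      rel_mset_Plus[OF combinesI[of \<Delta> \<Gamma> "[1]" "[1]"] rel_mset_combines_refl]]
  have "provable (add_mset (\<Gamma> + \<Delta>) G + G)"
    by simp
  then have "provable (G + G + {#\<Gamma> + \<Delta>#})"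
    by simp
  from provable_contract[OF this] show ?thesis
    by simp
qed

section \<open>Removal of M from CAN-free derivations\<close>

lemma CAN_free_derivation_imp_provable:
  "derivation d \<Longrightarrow> CAN_free d \<Longrightarrow> provable (concl d)"
proof (induction d)
  case (Node \<rho> H ds)
  have prems: "provable P" if "P \<in> set (map concl ds)" for P
    using that Node by (auto simp: CAN_free_def)
  have inst: "hmr_inst \<rho> (map concl ds) H" and "\<rho> \<noteq> R_CAN"
    using Node.prems by (auto simp: CAN_free_def)
  show ?case
  proof (cases "\<rho> = R_M")
    case True
    with inst obtain G \<Gamma> \<Delta> where
      "map concl ds = [add_mset \<Gamma> G, add_mset \<Delta> G]" "H = add_mset (\<Gamma> + \<Delta>) G"
      by (auto elim: hmr_inst.cases)
    with prems show ?thesis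
      by (simp add: provable_M)
  next
    case False
    with inst \<open>\<rho> \<noteq> R_CAN\<close> prems have "provable H"
      by (blast intro: provable.step)
    then show ?thesis
      by simp
  qed
qed

theorem theorem4p11:
  fixes H :: "'v::countable hypersequent"
  assumes "\<exists>d. derivation d \<and> concl d = H \<and> CAN_free d"
  shows "\<exists>d. derivation d \<and> concl d = H \<and> CAN_free d \<and> M_free d"
  using assms CAN_free_derivation_imp_provable provable_imp_derivation by blast

end
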